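(* Let $r\ge 0$, $k\ge 3$ and $m\ge r+k$ be integers, and let $g=m-(r+k)$. Let $([m],\mathcal{D})$ be a maximal $(g+1)\text{-}(m,g+2,k-1)$ packing design with the additional property (P): no block in $\mathcal{D}$ appears more than $k-2$ times. Let $A$ be the $\{0,1\}$-matrix with $m$ rows whose columns are (the indicator vectors of) the complements in $[m]$ of the blocks in $\mathcal{D}$, one column per block counted with multiplicity; let $n$ be the number of columns of $A$. Then $A$ represents an $r\text{-ECBC}(n,k,m)$, and $n\le F(k,m,r)$.
   Context: For a nonnegative integer $s$, $[s]=\{1,\dots,s\}$. An $r\text{-ECBC}(n,k,m)$ (erasure combinatorial batch code with redundancy $r$, with at most one item read from each server) is a multifamily $\{B_1,\dots,B_m\}$ of $m$ subsets of $[n]$ such that for each $Y\subseteq[n]$ with $|Y|\le k$ and each $J\subseteq[m]$ with $|J|\ge m-r$ there exist subsets $C_j\subseteq B_j$ ($j\in J$) with $|C_j|\le 1$ and $Y=\bigcup_{j\in J}C_j$. The parameters of an $r\text{-ECBC}(n,k,m)$ are always assumed to satisfy $r<m$ and $1\le k\le\min\{n,m-r\}$. An $m\times n$ $\{0,1\}$-matrix $A=(a_{ij})$ represents the multifamily with $B_i=\{j: a_{ij}=1\}$; its $j$-th column is identified with the set $A_j=\{i\in[m]: a_{ij}=1\}$. $F(k,m,r)$ denotes the largest $n$ such that there exists an $r\text{-ECBC}(n,k,m)$ in which each column has cardinality $r+k-2$. A $t\text{-}(v,\kappa,\lambda)$ packing design is a pair $(X,\mathcal{D})$ where $X$ is a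 set with $|X|=v$ and $\mathcal{D}$ is a family (repetitions allowed) of subsets of $X$, called blocks, each of cardinality $\kappa$, such that each $t$-subset of $X$ is contained in at most $\lambda$ blocks, counted with multiplicity. "Maximal" means having the largest number of blocks (counted with multiplicity) among packing designs with the given parameters and property (P). *)

theory Defs
  imports "Jordan_Normal_Form.Matrix" "HOL-Library.Multiset"
begin

text \<open>
  The set \<open>[s]\<close> is \<open>{1..s}\<close>. Rows and columns of a library matrix are numbered from 0,
  so the mathematical entry \<open>a\<^sub>i\<^sub>j\<close> is \<open>A $$ (i - 1, j - 1)\<close>.
\<close>

text \<open>
  A multifamily \<open>B\<^sub>1, \<dots>, B\<^sub>m\<close> is a function on indices; only its values on \<open>{1..m}\<close> matter.
  The standing assumptions on the parameters are part of the definition.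
\<close>

definition is_ECBC :: "nat \<Rightarrow> nat \<Rightarrow> nat \<Rightarrow> nat \<Rightarrow> (nat \<Rightarrow> nat set) \<Rightarrow> bool" where
  "is_ECBC r n k m B \<longleftrightarrow>
     r < m \<and> 1 \<le> k \<and> k \<le> min n (m - r) \<and>
     (\<forall>i\<in>{1..m}. B i \<subseteq> {1..n}) \<and>
     (\<forall>Y J. Y \<subseteq> {1..n} \<and> card Y \<le> k \<and> J \<subseteq> {1..m} \<and> card J \<ge> m - r \<longrightarrow>
        (\<exists>C. (\<forall>j\<in>J. C j \<subseteq> B j \<and> card (C j) \<le> 1) \<and> Y = (\<Union>j\<in>J. C j)))"

definition row_set :: "nat mat \<Rightarrow> nat \<Rightarrow> nat set" where
  "row_set A i = {j \<in> {1..dim_col A}. A $$ (i - 1, j - 1) = 1}"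

definition col_set :: "nat mat \<Rightarrow> nat \<Rightarrow> nat set" where
  "col_set A j = {i \<in> {1..dim_row A}. A $$ (i - 1, j - 1) = 1}"

definition represents_ECBC :: "nat mat \<Rightarrow> nat \<Rightarrow> nat \<Rightarrow> nat \<Rightarrow> nat \<Rightarrow> bool" where
  "represents_ECBC A r n k m \<longleftrightarrow>
     A \<in> carrier_mat m n \<and> elements_mat A \<subseteq> {0, 1} \<and> is_ECBC r n k m (row_set A)"

text \<open>
  The column size \<open>r + k - 2\<close> is written additively to avoid truncated subtraction.
  For \<open>k \<ge> 3\<close> and \<open>m \<ge> r + k\<close> the admissible \<open>n\<close> form a nonempty bounded set: any \<open>k - 1\<close>
  columns have a union of size at least \<open>r + k - 1\<close>, so no column occurs more than \<open>k - 2\<close>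
  times.
\<close>

definition max_ECBC :: "nat \<Rightarrow> nat \<Rightarrow> nat \<Rightarrow> nat" where
  "max_ECBC k m r =
     (GREATEST n. \<exists>A. represents_ECBC A r n k m \<and> (\<forall>j\<in>{1..n}. card (col_set A j) + 2 = r + k))"

text \<open>Blocks form a multiset, so repeated blocks are counted with multiplicity.\<close>

definition packing_design ::
    "nat \<Rightarrow> nat \<Rightarrow> nat \<Rightarrow> nat \<Rightarrow> 'a set \<Rightarrow> 'a set multiset \<Rightarrow> bool" where
  "packing_design t v \<kappa> l X D \<longleftrightarrow>
     finite X \<and> card X = v \<and>
     (\<forall>B\<in>#D. B \<subseteq> X \<and> card B = \<kappa>) \<and>
     (\<forall>T. T \<subseteq> X \<and> card T = t \<longrightarrow> size {#B \<in># D. T \<subseteq> B#} \<le> l)"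

definition block_mult_le :: "nat \<Rightarrow> 'a set multiset \<Rightarrow> bool" where
  "block_mult_le q D \<longleftrightarrow> (\<forall>B\<in>#D. count D B \<le> q)"

definition maximal_packing_design ::
    "('a set multiset \<Rightarrow> bool) \<Rightarrow> nat \<Rightarrow> nat \<Rightarrow> nat \<Rightarrow> nat \<Rightarrow> 'a set \<Rightarrow> 'a set multiset \<Rightarrow> bool" where
  "maximal_packing_design P t v \<kappa> l X D \<longleftrightarrow>
     packing_design t v \<kappa> l X D \<and> P D \<and>
     (\<forall>X' D'. packing_design t v \<kappa> l X' D' \<and> P D' \<longrightarrow> size D' \<le> size D)"

definition indicator_vec :: "nat \<Rightarrow> nat set \<Rightarrow> nat vec" where
  "indicator_vec m S = vec m (\<lambda>i. if i + 1 \<in> S then 1 else 0)"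

end

theory Submission
  imports Defs
begin

text \<open>
  By Hall's marriage theorem, \<open>k\<close> items can be retrieved one per server after any \<open>r\<close> servers
  fail if and only if every nonempty set \<open>S\<close> of at most \<open>k\<close> columns has a union of at least
  \<open>r + |S|\<close> elements (\<open>ECBC_union_condition\<close>, \<open>is_ECBC_I\<close>). Passing to complements in \<open>[m]\<close>, with
  \<open>m = r + k + g\<close>, this says that the blocks indexed by \<open>S\<close> meet in a set \<open>K\<close> with
  \<open>|S| + |K| \<le> k + g\<close>. A block has \<open>g + 2\<close> elements, so only two cases need an argument. If
  \<open>|K| = g + 1\<close>, the packing condition for \<open>K\<close> allows at most \<open>k - 1\<close> blocks. If
  \<open>|K| = g + 2\<close>, all the blocks are equal to \<open>K\<close>, and property (P) allows at most \<open>k - 2\<close> of them.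
  The case \<open>|K| \<le> g\<close> is trivial as \<open>|S| \<le> k\<close>. This is \<open>card_plus_card_Inter_blocks_le\<close>.

  Two points remain. The definition of a code requires \<open>k \<le> n\<close>; this is where maximality enters,
  since there is an explicit packing with property (P) and \<open>k\<close> blocks
  (\<open>maximal_packing_size_ge\<close>). And \<open>n \<le> F(k, m, r)\<close> needs the largest \<open>n\<close> to exist: with
  columns of size \<open>r + k - 2\<close>, the union condition for \<open>k - 1\<close> columns excludes \<open>k - 1\<close> equal ones,
  so \<open>n \<le> 2\<^sup>m (k - 2)\<close> (\<open>ECBC_columns_bounded\<close>).
\<close>

section \<open>Hall's marriage theorem\<close>

text \<open>
  This is the induction of Halmos and Vaughan. If every nonempty proper subset has a neighbour to
  spare, one element may be matched arbitrarily and removed together with its partner. Otherwise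
  some proper subset \<open>S\<close> is tight. Then \<open>S\<close> is matched into its own neighbourhood, and the
  remaining elements still satisfy Hall's condition outside that neighbourhood: if \<open>T\<close> violated it
  there, \<open>S \<union> T\<close> would violate it originally.
\<close>

lemma Hall_marriage:
  fixes N :: "'a \<Rightarrow> 'b set"
  assumes "finite I" "\<And>i. i \<in> I \<Longrightarrow> finite (N i)"
    and "\<And>S. S \<subseteq> I \<Longrightarrow> card S \<le> card (\<Union>i\<in>S. N i)"
  shows "\<exists>f. inj_on f I \<and> (\<forall>i\<in>I. f i \<in> N i)"
  using assms
proof (induction "card I" arbitrary: I N rule: less_induct)
  case less
  note fin = less.prems(1) and finN = less.prems(2) and hall = less.prems(3)
  have finU: "finite (\<Union>i\<in>S. N i)" if "S \<subseteq> I" for S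
    using that fin finN by (meson finite_UN_I finite_subset subsetD)
  show ?case
  proof (cases "\<exists>S. S \<subset> I \<and> S \<noteq> {} \<and> card S = card (\<Union>i\<in>S. N i)")
    case True
    then obtain S where S: "S \<subset> I" "S \<noteq> {}" and tight: "card S = card (\<Union>i\<in>S. N i)" by blast
    have finS: "finite S" using S fin finite_subset by blast
    have "card S < card I" using S fin by (simp add: psubset_card_mono)
    moreover have "card S' \<le> card (\<Union>i\<in>S'. N i)" if "S' \<subseteq> S" for S'
      using hall[of S'] that S by blast
    ultimately obtain f where f: "inj_on f S" "\<forall>i\<in>S. f i \<in> N i"
      using less.hyps[of S N] finS finN S by blast
    let ?U = "\<Union>i\<in>S. N i"
    have "card (I - S) < card I"
      using S fin by (intro psubset_card_mono) auto
    moreover have "card T \<le> card (\<Union>i\<in>T. N i - ?U)" if T: "T \<subseteq> I - S" for T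
    proof -
      have finT: "finite T" using T fin by (meson finite_Diff finite_subset)
      have "card S + card T = card (S \<union> T)"
        using T finT finS by (subst card_Un_disjoint) auto
      also have "\<dots> \<le> card (\<Union>i\<in>S \<union> T. N i)" using hall[of "S \<union> T"] T S by blast
      also have "(\<Union>i\<in>S \<union> T. N i) = ?U \<union> (\<Union>i\<in>T. N i - ?U)" by blast
      also have "card \<dots> \<le> card ?U + card (\<Union>i\<in>T. N i - ?U)" by (rule card_Un_le)
      finally show ?thesis using tight by simp
    qed
    ultimately obtain h where h: "inj_on h (I - S)" "\<forall>i\<in>I - S. h i \<in> N i - ?U"
      using less.hyps[of "I - S" "\<lambda>i. N i - ?U"] fin finN by (metis Diff_iff finite_Diff)
    let ?f = "\<lambda>i. if i \<in> S then f i else h i"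
    have "inj_on ?f I"
      using f h unfolding inj_on_def by (smt (verit) Diff_iff UN_I)
    then show ?thesis using f h by (intro exI[of _ ?f]) auto
  next
    case False
    show ?thesis
    proof (cases "I = {}")
      case False
      then obtain a where a: "a \<in> I" by blast
      have "N a \<noteq> {}" using hall[of "{a}"] a by auto
      then obtain b where b: "b \<in> N a" by blast
      have "card (I - {a}) < card I" using a fin by (intro psubset_card_mono) auto
      moreover have "card T \<le> card (\<Union>i\<in>T. N i - {b})" if T: "T \<subseteq> I - {a}" for T
      proof (cases "T = {}")
        case False
        have TI: "T \<subset> I" using T a by blast
        then have "card T < card (\<Union>i\<in>T. N i)"
          using False \<open>\<not> (\<exists>S. S \<subset> I \<and> S \<noteq> {} \<and> card S = card (\<Union>i\<in>S. N i))\<close> hall[of T]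
          by (metis le_neq_implies_less psubset_imp_subset)
        moreover have "(\<Union>i\<in>T. N i - {b}) = (\<Union>i\<in>T. N i) - {b}" by blast
        moreover have "card (\<Union>i\<in>T. N i) - 1 \<le> card ((\<Union>i\<in>T. N i) - {b})"
          by (metis diff_card_le_card_Diff card.empty card_insert_disjoint empty_iff finite.intros One_nat_def)
        ultimately show ?thesis by simp
      qed simp
      ultimately obtain h where h: "inj_on h (I - {a})" "\<forall>i\<in>I - {a}. h i \<in> N i - {b}"
        using less.hyps[of "I - {a}" "\<lambda>i. N i - {b}"] fin finN by (metis Diff_iff finite_Diff)
      have "inj_on (h(a := b)) I"
        using h unfolding inj_on_def by (auto split: if_splits)
      then show ?thesis using h b by (intro exI[of _ "h(a := b)"]) auto
    qed simp
  qed
qed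

section \<open>The union condition for codes\<close>

text \<open>
  Losing \<open>r\<close> servers costs a set \<open>S\<close> of columns at most \<open>r\<close> elements of its union, so at least
  \<open>|S|\<close> of them remain: Hall's condition for matching the requested items to surviving servers.
\<close>

lemma is_ECBC_I:
  assumes "r < m" "1 \<le> k" "k \<le> min n (m - r)"
    and rows: "\<And>i. i \<in> {1..m} \<Longrightarrow> B i \<subseteq> {1..n}"
    and un: "\<And>S. \<lbrakk>S \<subseteq> {1..n}; S \<noteq> {}; card S \<le> k\<rbrakk> \<Longrightarrow>
               r + card S \<le> card {i \<in> {1..m}. B i \<inter> S \<noteq> {}}"
  shows "is_ECBC r n k m B"
  unfolding is_ECBC_def
proof (intro conjI allI impI)
  fix Y J
  assume "Y \<subseteq> {1..n} \<and> card Y \<le> k \<and> J \<subseteq> {1..m} \<and> m - r \<le> card J"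
  then have Y: "Y \<subseteq> {1..n}" "card Y \<le> k" and J: "J \<subseteq> {1..m}" "m - r \<le> card J" by auto
  have finY: "finite Y" and finJ: "finite J" using Y J finite_subset by blast+
  have lost: "card ({1..m} - J) \<le> r" using J finJ \<open>r < m\<close> by (simp add: card_Diff_subset)
  have "card S \<le> card (\<Union>y\<in>S. {j \<in> J. y \<in> B j})" if S: "S \<subseteq> Y" for S
  proof (cases "S = {}")
    case False
    have "r + card S \<le> card {i \<in> {1..m}. B i \<inter> S \<noteq> {}}"
      using un[of S] S Y False card_mono[OF finY S] by (meson order_trans)
    also have "\<dots> \<le> card ((\<Union>y\<in>S. {j \<in> J. y \<in> B j}) \<union> ({1..m} - J))"
    proof (rule card_mono)
      have "(\<Union>y\<in>S. {j \<in> J. y \<in> B j}) \<subseteq> J" by blast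
      then show "finite ((\<Union>y\<in>S. {j \<in> J. y \<in> B j}) \<union> ({1..m} - J))"
        using finJ finite_subset by blast
    qed auto
    also have "\<dots> \<le> card (\<Union>y\<in>S. {j \<in> J. y \<in> B j}) + card ({1..m} - J)" by (rule card_Un_le)
    finally show ?thesis using lost by linarith
  qed simp
  from Hall_marriage[OF finY _ this] finJ
  obtain f where f: "inj_on f Y" "\<forall>y\<in>Y. f y \<in> {j \<in> J. y \<in> B j}" by auto
  \<comment> \<open>Injectivity of the matching is what limits each server to one item.\<close>
  let ?C = "\<lambda>j. {y \<in> Y. f y = j}"
  have "card (?C j) \<le> 1" for j
    using f(1) finY by (auto simp: card_le_Suc0_iff_eq inj_on_def)
  moreover have "?C j \<subseteq> B j" for j using f(2) by auto
  moreover have "Y = (\<Union>j\<in>J. ?C j)" using f(2) by auto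
  ultimately show "\<exists>C. (\<forall>j\<in>J. C j \<subseteq> B j \<and> card (C j) \<le> 1) \<and> Y = (\<Union>j\<in>J. C j)"
    by (intro exI[of _ ?C]) simp
qed (use assms in auto)

text \<open>
  The converse: if the union of the columns in \<open>S\<close> were too small, deleting \<open>r\<close> of its elements
  (or all of them, if there are fewer) would leave fewer than \<open>|S|\<close> servers that hold anything from \<open>S\<close>.
\<close>

lemma ECBC_union_condition:
  assumes code: "is_ECBC r n k m B"
    and S: "S \<subseteq> {1..n}" "S \<noteq> {}" "card S \<le> k"
  shows "r + card S \<le> card {i \<in> {1..m}. B i \<inter> S \<noteq> {}}" (is "_ \<le> card ?U")
proof (rule ccontr)
  assume "\<not> ?thesis"
  then have small: "card ?U < r + card S" by simp
  have finS: "finite S" using S finite_subset by blast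
  have Spos: "card S > 0" using S finS by (simp add: card_gt_0_iff)
  have finU: "finite ?U" by simp
  obtain R where R: "R \<subseteq> ?U" "card R = min r (card ?U)"
    using obtain_subset_with_card_n[of "min r (card ?U)" ?U] by auto
  have finR: "finite R" using R(1) finU finite_subset by blast
  let ?J = "{1..m} - R"
  have "R \<subseteq> {1..m}" using R by blast
  then have "card ?J = m - card R" using finR by (simp add: card_Diff_subset)
  then have "m - r \<le> card ?J" using R(2) by simp
  with S have "S \<subseteq> {1..n} \<and> card S \<le> k \<and> ?J \<subseteq> {1..m} \<and> card ?J \<ge> m - r" by blast
  with code have "\<exists>C. (\<forall>j\<in>?J. C j \<subseteq> B j \<and> card (C j) \<le> 1) \<and> S = (\<Union>j\<in>?J. C j)"
    unfolding is_ECBC_def by presburger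
  then obtain C where C: "\<forall>j\<in>?J. C j \<subseteq> B j \<and> card (C j) \<le> 1" "S = (\<Union>j\<in>?J. C j)"
    by (elim exE conjE)
  have empty: "C j = {}" if "j \<in> ?J - ?U" for j using C that by blast
  have "S = (\<Union>j\<in>?U - R. C j)"
  proof
    show "S \<subseteq> (\<Union>j\<in>?U - R. C j)" using C(2) empty by blast
    show "(\<Union>j\<in>?U - R. C j) \<subseteq> S" using C(2) by blast
  qed
  then have "card S \<le> (\<Sum>j\<in>?U - R. card (C j))"
    using card_UN_le[of "?U - R" C] finU by simp
  also have "\<dots> \<le> (\<Sum>j\<in>?U - R. 1)" using C(1) by (intro sum_mono) auto
  also have "\<dots> = card ?U - card R" using R finR by (simp add: card_Diff_subset)
  finally show False using R(2) small Spos by linarith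
qed

lemma rows_meeting_columns:
  assumes "S \<subseteq> {1..dim_col A}"
  shows "{i \<in> {1..dim_row A}. row_set A i \<inter> S \<noteq> {}} = (\<Union>j\<in>S. col_set A j)"
  using assms by (fastforce simp: row_set_def col_set_def)

text \<open>
  The union condition for \<open>k - 1\<close> columns rules out \<open>k - 1\<close> copies of a set of size
  \<open>r + k - 2\<close>. Hence each of the at most \<open>2\<^sup>m\<close> possible columns is used at most \<open>k - 2\<close> times.
\<close>

lemma ECBC_columns_bounded:
  assumes rep: "represents_ECBC A r n k m" and "k \<ge> 2"
    and col: "\<forall>j\<in>{1..n}. card (col_set A j) + 2 = r + k"
  shows "n \<le> 2 ^ m * (k - 2)"
proof -
  have dim: "dim_row A = m" "dim_col A = n" and code: "is_ECBC r n k m (row_set A)"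
    using rep by (auto simp: represents_ECBC_def)
  let ?F = "\<lambda>c. {j \<in> {1..n}. col_set A j = c}"
  have fibre: "card (?F c) \<le> k - 2" for c
  proof (rule ccontr)
    assume "\<not> card (?F c) \<le> k - 2"
    then have "k - 1 \<le> card (?F c)" by simp
    then obtain S where S: "S \<subseteq> ?F c" "card S = k - 1"
      by (rule obtain_subset_with_card_n)
    have "S \<noteq> {}" using S \<open>k \<ge> 2\<close> by auto
    then obtain j where j: "j \<in> S" by blast
    have "(\<Union>j\<in>S. col_set A j) = c" using S j by blast
    moreover have "S \<subseteq> {1..n}" using S by blast
    ultimately have "r + card S \<le> card c"
      using ECBC_union_condition[OF code, of S] rows_meeting_columns[of S A] S \<open>S \<noteq> {}\<close> dim
      by simp
    moreover have "card c + 2 = r + k" using col j S by blast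
    ultimately show False using S(2) \<open>k \<ge> 2\<close> by simp
  qed
  have "col_set A j \<in> Pow {1..m}" for j using dim(1) by (auto simp: col_set_def)
  then have "{1..n} = (\<Union>c\<in>Pow {1..m}. ?F c)" by blast
  then have "card {1..n} \<le> (\<Sum>c\<in>Pow {1..m}. card (?F c))"
    using card_UN_le[of "Pow {1..m}" ?F] by (metis finite_Pow_iff finite_atLeastAtMost)
  also have "\<dots> \<le> (\<Sum>c\<in>Pow {1..m}. k - 2)" by (intro sum_mono fibre)
  finally show ?thesis by (simp add: card_Pow)
qed

lemma max_ECBC_ge:
  assumes "represents_ECBC A r n k m" "k \<ge> 2"
    and "\<forall>j\<in>{1..n}. card (col_set A j) + 2 = r + k"
  shows "n \<le> max_ECBC k m r"
  unfolding max_ECBC_def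
  by (rule Greatest_le_nat[where b = "2 ^ m * (k - 2)"])
    (use assms ECBC_columns_bounded in blast)+

section \<open>Packing designs\<close>

lemma size_filter_image_mset_set:
  assumes "finite I"
  shows "size (filter_mset P (image_mset b (mset_set I))) = card {j \<in> I. P (b j)}"
  using assms by (simp add: filter_mset_image_mset)

text \<open>
  The union condition in terms of complements. Only the intersection \<open>K\<close> matters, and its size
  decides which of the hypotheses bounds the number of blocks through it.
\<close>

lemma card_plus_card_Inter_blocks_le:
  assumes pack: "packing_design (g + 1) m (g + 2) (k - 1) X (image_mset b (mset_set I))"
    and mult: "block_mult_le (k - 2) (image_mset b (mset_set I))"
    and "finite I" "k \<ge> 2" and S: "S \<subseteq> I" "S \<noteq> {}" "card S \<le> k"
  shows "card S + card (\<Inter>j\<in>S. b j) \<le> k + g"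
proof -
  let ?K = "\<Inter>j\<in>S. b j"
  have finX: "finite X" and blk: "\<And>j. j \<in> I \<Longrightarrow> b j \<subseteq> X \<and> card (b j) = g + 2"
    using pack \<open>finite I\<close> by (auto simp: packing_design_def)
  have finb: "finite (b j)" if "j \<in> S" for j using that S blk finX finite_subset by blast
  have cardb: "card (b j) = g + 2" if "j \<in> S" for j using that S blk by blast
  obtain j where j: "j \<in> S" using S by blast
  have K: "?K \<subseteq> b j" using j by blast
  then have "card ?K \<le> g + 2" using card_mono[OF finb[OF j] K] cardb[OF j] by simp
  then consider "card ?K \<le> g" | "card ?K = g + 1" | "card ?K = g + 2" by linarith
  then show ?thesis
  proof cases
    case 1
    then show ?thesis using S by simp
  next
    case 2
    have "?K \<subseteq> X" using K j blk S by blast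
    then have "size {#B \<in># image_mset b (mset_set I). ?K \<subseteq> B#} \<le> k - 1"
      using pack 2 unfolding packing_design_def by blast
    then have "card {i \<in> I. ?K \<subseteq> b i} \<le> k - 1"
      using \<open>finite I\<close> by (simp add: size_filter_image_mset_set)
    moreover have "card S \<le> card {i \<in> I. ?K \<subseteq> b i}"
      using S \<open>finite I\<close> by (intro card_mono) auto
    ultimately show ?thesis using 2 \<open>k \<ge> 2\<close> by linarith
  next
    case 3
    have eq: "b i = ?K" if "i \<in> S" for i
      using card_subset_eq[OF finb[OF that], of ?K] cardb[OF that] that 3 by (metis INT_lower)
    then have "S \<subseteq> {i \<in> I. b i = ?K}" using S(1) by blast
    then have "card S \<le> card {i \<in> I. b i = ?K}"
      using \<open>finite I\<close> by (intro card_mono) simp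
    also have "\<dots> = count (image_mset b (mset_set I)) ?K"
      using \<open>finite I\<close> by (simp add: count_image_mset' eq_commute[of "?K"])
    also have "\<dots> \<le> k - 2"
    proof -
      have "b j \<in># image_mset b (mset_set I)" using j S(1) \<open>finite I\<close> by auto
      then show ?thesis using mult eq[OF j] unfolding block_mult_le_def by metis
    qed
    finally show ?thesis using 3 \<open>k \<ge> 2\<close> by linarith
  qed
qed

text \<open>
  Three \<open>(g + 2)\<close>-subsets of a \<open>(g + 3)\<close>-set meet in only \<open>g\<close> elements, so a \<open>(g + 1)\<close>-set lies in
  at most two of them. Taking one of the three \<open>k - 2\<close> times and the others once gives \<open>k\<close> blocks
  with at most \<open>(k - 2) + 1\<close> through any \<open>(g + 1)\<close>-set.
\<close>

lemma maximal_packing_size_ge: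
  fixes D :: "nat set multiset"
  assumes max: "maximal_packing_design (block_mult_le (k - 2)) (g + 1) m (g + 2) (k - 1) X D"
    and "k \<ge> 3" "g + 3 \<le> m"
  shows "k \<le> size D"
proof -
  define Q where "Q a = {1..g + 3} - {a}" for a :: nat
  let ?D = "replicate_mset (k - 2) (Q 1) + {#Q 2, Q 3#}"
  have Q: "Q a \<subseteq> {1..m}" "card (Q a) = g + 2" if "a \<in> {1, 2, 3}" for a
    using that \<open>g + 3 \<le> m\<close> unfolding Q_def by auto
  have inj: "Q a \<noteq> Q c" if "a \<in> {1, 2, 3}" "c \<in> {1, 2, 3}" "a \<noteq> c" for a c
  proof -
    have "c \<in> Q a" "c \<notin> Q c" using that unfolding Q_def by auto
    then show ?thesis by metis
  qed
  have "size {#B \<in># ?D. T \<subseteq> B#} \<le> k - 1" if "card T = g + 1" for T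
  proof -
    have "\<not> (T \<subseteq> Q 1 \<and> T \<subseteq> Q 2 \<and> T \<subseteq> Q 3)"
    proof
      assume "T \<subseteq> Q 1 \<and> T \<subseteq> Q 2 \<and> T \<subseteq> Q 3"
      then have sub: "T \<subseteq> {4..g + 3}" unfolding Q_def by fastforce
      show False using card_mono[OF _ sub] that by simp
    qed
    moreover have "size (filter_mset ((\<subseteq>) T) (replicate_mset l (Q 1))) = (if T \<subseteq> Q 1 then l else 0)"
      for l by (induction l) auto
    ultimately show ?thesis using \<open>k \<ge> 3\<close> by auto
  qed
  then have "packing_design (g + 1) m (g + 2) (k - 1) {1..m} ?D"
    unfolding packing_design_def using Q \<open>k \<ge> 3\<close> by auto
  moreover have "block_mult_le (k - 2) ?D"
    unfolding block_mult_le_def using inj \<open>k \<ge> 3\<close> by auto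
  ultimately have "size ?D \<le> size D"
    using max unfolding maximal_packing_design_def by blast
  then show ?thesis using \<open>k \<ge> 3\<close> by simp
qed

section \<open>Codes from packing designs\<close>

text \<open>
  Reading the blocks off the columns lets the index set of the columns also index the blocks, which
  takes care of multiplicities.
\<close>

lemma blocks_eq_column_complements:
  assumes A: "A \<in> carrier_mat m n"
    and cols: "mset (cols A) = image_mset (\<lambda>B. indicator_vec m ({1..m} - B)) D"
    and sub: "\<forall>B\<in>#D. B \<subseteq> {1..m}"
  shows "D = image_mset (\<lambda>j. {1..m} - col_set A j) (mset_set {1..n})"
proof -
  \<comment> \<open>A left inverse of the map from a block to its column.\<close>
  define h :: "nat vec \<Rightarrow> nat set" where "h v = {1..m} - {i \<in> {1..m}. v $ (i - 1) = 1}" for v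
  have "h (indicator_vec m ({1..m} - B)) = B" if "B \<subseteq> {1..m}" for B
    using that unfolding h_def indicator_vec_def by (auto split: if_splits)
  then have "D = image_mset h (mset (cols A))"
    using sub unfolding cols by (simp add: multiset.map_comp comp_def cong: image_mset_cong)
  also have "mset (cols A) = image_mset (\<lambda>j. col A (j - 1)) (mset_set {1..n})"
  proof -
    have "mset_set {1..n} = image_mset Suc (mset_set {0..<n})"
      by (simp add: image_mset_mset_set image_Suc_atLeastLessThan atLeastLessThanSuc_atLeastAtMost)
    then show ?thesis using A by (simp add: cols_def multiset.map_comp comp_def)
  qed
  also have "image_mset h \<dots> = image_mset (\<lambda>j. h (col A (j - 1))) (mset_set {1..n})"
    by (simp add: multiset.map_comp comp_def)
  also have "\<dots> = image_mset (\<lambda>j. {1..m} - col_set A j) (mset_set {1..n})"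
  proof (rule image_mset_cong)
    fix j assume "j \<in># mset_set {1..n}"
    then show "h (col A (j - 1)) = {1..m} - col_set A j"
      using A unfolding h_def col_set_def by auto
  qed
  finally show ?thesis .
qed

lemma elements_mat_indicator_cols:
  assumes "A \<in> carrier_mat m n"
    and "set (cols A) \<subseteq> range (indicator_vec m)"
  shows "elements_mat A \<subseteq> {0, 1}"
proof
  fix x assume "x \<in> elements_mat A"
  then obtain i j where ij: "i < m" "j < n" "x = A $$ (i, j)"
    using assms(1) unfolding elements_mat_def by auto
  then have "col A j \<in> set (cols A)" using assms(1) by (auto simp: cols_def)
  then obtain T where "col A j = indicator_vec m T" using assms(2) by blast
  moreover have "x = col A j $ i" using ij assms(1) by simp
  ultimately show "x \<in> {0, 1}" using ij(1) by (simp add: indicator_vec_def)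
qed

theorem lemma25:
  fixes r k m g n :: nat
    and D :: "nat set multiset"
    and A :: "nat mat"
  assumes "k \<ge> 3"
    and "m \<ge> r + k"
    and "g = m - (r + k)"
    and "maximal_packing_design (block_mult_le (k - 2)) (g + 1) m (g + 2) (k - 1) {1..m} D"
    and "A \<in> carrier_mat m n"
    and "mset (cols A) = image_mset (\<lambda>B. indicator_vec m ({1..m} - B)) D"
  shows "represents_ECBC A r n k m \<and> n \<le> max_ECBC k m r"
proof -
  note A = \<open>A \<in> carrier_mat m n\<close>
  have m: "m = r + k + g" using assms(2,3) by simp
  have pack: "packing_design (g + 1) m (g + 2) (k - 1) {1..m} D"
    and mult: "block_mult_le (k - 2) D"
    using assms(4) by (auto simp: maximal_packing_design_def)
  let ?b = "\<lambda>j. {1..m} - col_set A j"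
  have D: "D = image_mset ?b (mset_set {1..n})"
    using pack by (intro blocks_eq_column_complements[OF A assms(6)])
      (auto simp: packing_design_def)
  have col_sub: "col_set A j \<subseteq> {1..m}" for j using A by (auto simp: col_set_def)
  have "k \<le> size D" using maximal_packing_size_ge[OF assms(4,1)] m assms(1) by simp
  then have kn: "k \<le> n" by (simp add: D)
  have "r + card S \<le> card {i \<in> {1..m}. row_set A i \<inter> S \<noteq> {}}"
    if S: "S \<subseteq> {1..n}" "S \<noteq> {}" "card S \<le> k" for S
  proof -
    let ?U = "\<Union>j\<in>S. col_set A j"
    have "?U \<subseteq> {1..m}" using col_sub by blast
    moreover have "(\<Inter>j\<in>S. ?b j) = {1..m} - ?U" using S(2) by blast
    ultimately have "card (\<Inter>j\<in>S. ?b j) = m - card ?U" "card ?U \<le> m"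
      using card_mono[of "{1..m}" ?U] by (auto simp: card_Diff_subset finite_subset)
    moreover have "card S + card (\<Inter>j\<in>S. ?b j) \<le> k + g"
      using card_plus_card_Inter_blocks_le[OF pack[unfolded D] mult[unfolded D]] S assms(1)
      by simp
    ultimately have "r + card S \<le> card ?U" using m by linarith
    then show ?thesis using rows_meeting_columns[of S A] S(1) A by simp
  qed
  then have "is_ECBC r n k m (row_set A)"
    using m kn assms(1) A by (intro is_ECBC_I) (auto simp: row_set_def)
  moreover have "elements_mat A \<subseteq> {0, 1}"
  proof (rule elements_mat_indicator_cols[OF A])
    have "set_mset (mset (cols A)) \<subseteq> range (indicator_vec m)" unfolding assms(6) by auto
    then show "set (cols A) \<subseteq> range (indicator_vec m)" by simp
  qed
  ultimately have rep: "represents_ECBC A r n k m" using A by (simp add: represents_ECBC_def)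
  have "card (col_set A j) + 2 = r + k" if "j \<in> {1..n}" for j
  proof -
    have "card (?b j) = g + 2" using pack that by (auto simp: packing_design_def D)
    then have "m - card (col_set A j) = g + 2"
      using col_sub[of j] by (simp add: card_Diff_subset finite_subset)
    then show ?thesis using m by linarith
  qed
  then have "n \<le> max_ECBC k m r" using max_ECBC_ge[OF rep] assms(1) by simp
  with rep show ?thesis ..
qed

end
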